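(* Let $B>0$, $d\in\mathbb{N}^*$, $\mathcal{Y}=[-B;B]$, and let the loss be $\ell(y,y')=|y-y'|^q$. For any training set size $n\in\mathbb{N}^*$, any $q$ with $1\le q\le1+\sqrt{\frac{\lfloor\log_2d\rfloor}{4n}\wedge1}$, and any input space $\mathcal{X}$ containing at least $\lfloor\log_2d\rfloor$ points, there exists a set $\mathcal{G}$ of $d$ prediction functions such that: for any estimator $\hat g$ there exists a probability distribution on the data space $\mathcal{X}\times[-B;B]$ for which $$\mathbb{E}R(\hat g)-\min_{g\in\mathcal{G}}R(g)\ge\begin{cases}c_qB^q\sqrt{\frac{\lfloor\log_2|\mathcal{G}|\rfloor}{n}},&\text{if }|\mathcal{G}|<2^{4n+1},\\ 2c_qB^q,&\text{otherwise,}\end{cases}$$ where $$c_q=\begin{cases}\frac14,&\text{if }q=1,\\ \frac{q}{40},&\text{if }1<q\le1+\sqrt{\frac{\lfloor\log_2|\mathcal{G}|\rfloor}{4n}\wedge1}.\end{cases}$$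
   Context: Prediction functions are (measurable) functions $\mathcal{X}\to\mathcal{Y}$. For a distribution $P$ on $\mathcal{X}\times\mathcal{Y}$, $R(g)=\mathbb{E}_{(X,Y)\sim P}|Y-g(X)|^q$. An estimator $\hat g$ maps a training set $Z_1^n\in(\mathcal{X}\times\mathcal{Y})^n$ to a prediction function $\hat g_{Z_1^n}$; $\mathbb{E}R(\hat g)=\mathbb{E}_{Z_1^n\sim P^{\otimes n}}R(\hat g_{Z_1^n})$. $\lfloor x\rfloor$ is the largest integer not exceeding $x$, $a\wedge b=\min(a,b)$, and $|\mathcal{G}|$ is the cardinality of $\mathcal{G}$ (here $|\mathcal{G}|=d$). Measurability of the manipulated quantities is implicitly assumed. *)

theory Defs
  imports "HOL-Probability.Probability"
begin

definition label_space :: "real \<Rightarrow> real measure" where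
  "label_space B = restrict_space borel {-B..B}"

definition data_space :: "'a measure \<Rightarrow> real \<Rightarrow> ('a \<times> real) measure" where
  "data_space X B = X \<Otimes>\<^sub>M label_space B"

definition distributions :: "'a measure \<Rightarrow> real \<Rightarrow> ('a \<times> real) measure set" where
  "distributions X B = {P. prob_space P \<and> sets P = sets (data_space X B)}"

text \<open>Functions are pinned to \<^term>\<open>undefined\<close> outside the carrier, so that the cardinality of a
  set of prediction functions counts functions on \<^term>\<open>space X\<close>, not on the ambient type.\<close>
definition prediction_functions :: "'a measure \<Rightarrow> real \<Rightarrow> ('a \<Rightarrow> real) set" where
  "prediction_functions X B = measurable X (label_space B) \<inter> extensional (space X)"

definition risk :: "real \<Rightarrow> ('a \<times> real) measure \<Rightarrow> ('a \<Rightarrow> real) \<Rightarrow> real" where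
  "risk q P g = (\<integral>z. \<bar>snd z - g (fst z)\<bar> powr q \<partial>P)"

text \<open>A training set is a tuple indexed by \<^term>\<open>{1..n}\<close>. The second conjunct is the implicit
  measurability assumption in its weakest form: the risk of the estimator, as a function of the
  training set, is measurable, so that its expectation makes sense. Joint measurability of
  \<open>(Z, x) \<mapsto> ghat Z x\<close> would imply it.\<close>
definition estimator ::
  "'a measure \<Rightarrow> real \<Rightarrow> real \<Rightarrow> nat \<Rightarrow> ((nat \<Rightarrow> 'a \<times> real) \<Rightarrow> 'a \<Rightarrow> real) \<Rightarrow> bool" where
  "estimator X B q n ghat \<longleftrightarrow>
     (\<forall>Z \<in> space (\<Pi>\<^sub>M i\<in>{1..n}. data_space X B). ghat Z \<in> prediction_functions X B) \<and>
     (\<forall>P \<in> distributions X B.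
        (\<lambda>Z. risk q P (ghat Z)) \<in> borel_measurable (\<Pi>\<^sub>M i\<in>{1..n}. data_space X B))"

definition expected_risk ::
  "real \<Rightarrow> nat \<Rightarrow> ('a \<times> real) measure \<Rightarrow> ((nat \<Rightarrow> 'a \<times> real) \<Rightarrow> 'a \<Rightarrow> real) \<Rightarrow> real" where
  "expected_risk q n P ghat = (\<integral>Z. risk q P (ghat Z) \<partial>(\<Pi>\<^sub>M i\<in>{1..n}. P))"

text \<open>The points of an input space must be distinguishable by its sigma-algebra, which holds in
  particular when singletons are measurable. Otherwise the number of points is meaningless: for the
  trivial sigma-algebra every prediction function is constant.\<close>
definition separates_points :: "'a measure \<Rightarrow> bool" where
  "separates_points X \<longleftrightarrow>
     (\<forall>x \<in> space X. \<forall>y \<in> space X. x \<noteq> y \<longrightarrow> (\<exists>A \<in> sets X. x \<in> A \<and> y \<notin> A))"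

definition c_const :: "real \<Rightarrow> real" where
  "c_const q = (if q = 1 then 1 / 4 else q / 40)"

end

theory Submission imports Defs
begin

text \<open>
  Put \<open>k = min \<lfloor>log\<^sub>2 d\<rfloor> (4 n)\<close> and \<open>\<delta> = sqrt (k / 4 n)\<close>. For each \<open>\<sigma> \<in> {-1, 1}\<^sup>k\<close> consider the
  distribution under which the input is uniform on \<open>k\<close> fixed points \<open>x\<^sub>j\<close> and the label at \<open>x\<^sub>j\<close> is
  \<open>\<sigma>\<^sub>j B\<close> with probability \<open>(1 + \<delta>) / 2\<close> and \<open>- \<sigma>\<^sub>j B\<close> otherwise. The set \<open>G\<close> contains all optimal
  predictors, with risk \<open>L\<close>. By convexity the two conditional risks of any prediction at \<open>x\<^sub>j\<close>, for
  \<open>\<sigma>\<^sub>j = 1\<close> and \<open>\<sigma>\<^sub>j = -1\<close>, average to at least \<open>B\<^sup>q\<close>; hence, on averaging over \<open>\<sigma>\<close>, the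
  excess risk is at least \<open>(1 - V) (B\<^sup>q - L)\<close>, where \<open>V\<close> is the total variation distance between the
  laws of the sample for two \<open>\<sigma>\<close> that differ in one coordinate. If \<open>N\<close> of the inputs hit the
  corresponding point, the Hellinger affinity of the labels shows that the conditional distance is
  at most \<open>\<delta> sqrt N \<le> 1 / 4 + \<delta>\<^sup>2 N\<close>, so \<open>V \<le> 1 / 4 + \<delta>\<^sup>2 n / k = 1 / 2\<close>. Finally \<open>B\<^sup>q - L \<ge> 4 c\<^sub>q \<delta> B\<^sup>q\<close> by
  testing the prediction \<open>B\<close> when \<open>q = 1\<close> and \<open>B / 2\<close> when \<open>q > 1\<close>.
\<close>

section \<open>Prediction functions\<close>

lemma space_label_space [simp]: "space (label_space B) = {-B..B}"
  by (simp add: label_space_def space_restrict_space)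

text \<open>Intersecting, for fixed \<open>x\<close>, the finitely many sets that separate
  \<open>x\<close> from the other points of \<open>F\<close> isolates \<open>x\<close> within
  \<open>F\<close>; the union of these isolating sets over \<open>S\<close> is the required set.
  Singletons may fail to be measurable.\<close>

lemma separates_points_finite:
  assumes "separates_points X" and "finite F" and "F \<subseteq> space X" and "S \<subseteq> F"
  shows "\<exists>U\<in>sets X. U \<inter> F = S"
proof -
  have "\<exists>A\<in>sets X. x \<in> A \<and> A \<inter> (F - {x}) = {}" if "x \<in> F" for x
  proof -
    have "\<forall>y\<in>F - {x}. \<exists>A. A \<in> sets X \<and> x \<in> A \<and> y \<notin> A"
    proof
      fix y assume "y \<in> F - {x}"
      then show "\<exists>A. A \<in> sets X \<and> x \<in> A \<and> y \<notin> A"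
        using assms(1)[unfolded separates_points_def, rule_format, of x y] assms(3) that by auto
    qed
    then have "\<exists>A. \<forall>y\<in>F - {x}. A y \<in> sets X \<and> x \<in> A y \<and> y \<notin> A y"
      by (rule bchoice)
    then obtain A where A: "\<forall>y\<in>F - {x}. A y \<in> sets X \<and> x \<in> A y \<and> y \<notin> A y" ..
    \<comment> \<open>The factor \<open>space X\<close> matters when \<open>F = {x}\<close>, since
      the inner intersection is then \<open>UNIV\<close>.\<close>
    have "space X \<inter> (\<Inter>y\<in>F - {x}. A y) \<in> sets X"
    proof (cases "F - {x} = {}")
      case False
      then show ?thesis
        using A assms(2) by (intro sets.Int sets.finite_INT) auto
    qed (metis INF_empty inf_top_right sets.top)
    moreover have "x \<in> space X \<inter> (\<Inter>y\<in>F - {x}. A y)"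
      using A that assms(3) by auto
    moreover have "(space X \<inter> (\<Inter>y\<in>F - {x}. A y)) \<inter> (F - {x}) = {}"
      using A by auto
    ultimately show ?thesis
      by (intro bexI[of _ "space X \<inter> (\<Inter>y\<in>F - {x}. A y)"]) simp_all
  qed
  then have "\<forall>x\<in>F. \<exists>A. A \<in> sets X \<and> x \<in> A \<and> A \<inter> (F - {x}) = {}"
    by blast
  then have "\<exists>A. \<forall>x\<in>F. A x \<in> sets X \<and> x \<in> A x \<and> A x \<inter> (F - {x}) = {}"
    by (rule bchoice)
  then obtain A where A: "\<forall>x\<in>F. A x \<in> sets X \<and> x \<in> A x \<and> A x \<inter> (F - {x}) = {}" ..
  have "(\<Union>x\<in>S. A x) \<in> sets X"
    using A assms(2,4) by (intro sets.finite_UN) (auto dest: finite_subset)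
  moreover have "(\<Union>x\<in>S. A x) \<inter> F = S"
  proof
    show "(\<Union>x\<in>S. A x) \<inter> F \<subseteq> S"
    proof
      fix y assume "y \<in> (\<Union>x\<in>S. A x) \<inter> F"
      then obtain x where "x \<in> S" "y \<in> A x" "y \<in> F" by auto
      then have "y = x"
        using A[rule_format, of x] assms(4) by auto
      with \<open>x \<in> S\<close> show "y \<in> S" by simp
    qed
    show "S \<subseteq> (\<Union>x\<in>S. A x) \<inter> F"
      using A assms(4) by auto
  qed
  ultimately show ?thesis
    by (rule bexI[rotated])
qed

text \<open>Supplies the optimal predictor for each sign pattern \<open>\<sigma>\<close>: it is
  \<open>u\<close> on a measurable set that meets the chosen points exactly where
  \<open>\<sigma>\<close> holds, and \<open>- u\<close> elsewhere.\<close>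

lemma exists_two_valued_prediction:
  fixes x :: "nat \<Rightarrow> 'a"
  assumes "separates_points X" and "inj_on x {..<k}" and "x ` {..<k} \<subseteq> space X" and "\<bar>u\<bar> \<le> B"
  shows "\<exists>g\<in>prediction_functions X B. \<forall>j<k. g (x j) = (if \<sigma> j then u else - u)"
proof -
  have "\<exists>U\<in>sets X. U \<inter> x ` {..<k} = x ` {j. j < k \<and> \<sigma> j}"
    by (rule separates_points_finite[OF assms(1) _ assms(3)]) auto
  then obtain U where U: "U \<in> sets X" "U \<inter> x ` {..<k} = x ` {j. j < k \<and> \<sigma> j}" ..
  have mem: "x j \<in> U \<longleftrightarrow> \<sigma> j" if "j < k" for j
  proof -
    have "x j \<in> U \<longleftrightarrow> x j \<in> x ` {j. j < k \<and> \<sigma> j}"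
      using U(2) that by blast
    also have "\<dots> \<longleftrightarrow> \<sigma> j"
      using inj_on_image_mem_iff[OF assms(2), of j "{j. j < k \<and> \<sigma> j}"] that by auto
    finally show ?thesis .
  qed
  define g where "g = (\<lambda>z\<in>space X. if z \<in> U then u else - u)"
  have "(\<lambda>z. if z \<in> U then u else - u) \<in> measurable X (label_space B)"
    using U(1) assms(4) by (intro measurable_If_set) (auto intro!: measurable_const)
  then have "g \<in> prediction_functions X B"
    by (auto simp: g_def prediction_functions_def cong: measurable_cong)
  moreover have "\<forall>j<k. g (x j) = (if \<sigma> j then u else - u)"
    using mem assms(3) by (auto simp: g_def)
  ultimately show ?thesis by blast
qed

text \<open>The constant functions already form an infinite family. This allows a small class of
  predictors to be padded to exactly \<open>d\<close> elements.\<close>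

lemma infinite_prediction_functions:
  assumes "B > 0" and "space X \<noteq> {}"
  shows "infinite (prediction_functions X B)"
proof
  let ?c = "\<lambda>u. \<lambda>z\<in>space X. u"
  assume "finite (prediction_functions X B)"
  moreover have "?c ` {-B..B} \<subseteq> prediction_functions X B"
    by (auto simp: prediction_functions_def intro!: measurable_const cong: measurable_cong)
  moreover have "inj_on ?c {-B..B}"
    using assms(2) by (force simp: inj_on_def fun_eq_iff)
  ultimately have "finite {-B..B}"
    by (metis finite_imageD finite_subset)
  then show False
    using infinite_Icc[of "-B" B] assms(1) by simp
qed

lemma exists_superset_with_card:
  assumes "infinite A" and "S \<subseteq> A" and "finite S" and "card S \<le> d"
  shows "\<exists>G. S \<subseteq> G \<and> G \<subseteq> A \<and> finite G \<and> card G = d"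
proof -
  obtain T where T: "T \<subseteq> A - S" "finite T" "card T = d - card S"
    using infinite_arbitrarily_large[of "A - S" "d - card S"] assms(1,3) by (metis Diff_infinite_finite)
  then have "card (S \<union> T) = d"
    using assms(3,4) by (subst card_Un_disjoint) auto
  then show ?thesis
    using T assms(2,3) by (intro exI[of _ "S \<union> T"]) auto
qed

section \<open>Total variation of samples\<close>

text \<open>Labels are encoded by their sign, \<open>True\<close> for \<open>B\<close> and
  \<open>False\<close> for \<open>- B\<close>; \<open>c\<close> is the favoured sign and
  \<open>\<delta>\<close> the bias towards it.\<close>

definition label_prob :: "real \<Rightarrow> bool \<Rightarrow> bool \<Rightarrow> real" where
  "label_prob \<delta> c b = (if b = c then (1 + \<delta>) / 2 else (1 - \<delta>) / 2)"

text \<open>Working with indices and signs instead of data points turns all expectations into finite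
  sums; the transfer to the data space comes later, through \<open>cube_point\<close>.\<close>

definition sample_prob :: "nat \<Rightarrow> real \<Rightarrow> (nat \<Rightarrow> bool) \<Rightarrow> nat \<times> bool \<Rightarrow> real" where
  "sample_prob k \<delta> \<sigma> z = label_prob \<delta> (\<sigma> (fst z)) (snd z) / real k"

lemma label_prob_nonneg: "\<bar>\<delta>\<bar> \<le> 1 \<Longrightarrow> 0 \<le> label_prob \<delta> c b"
  by (auto simp: label_prob_def)

lemma sum_label_prob: "(\<Sum>b\<in>UNIV. label_prob \<delta> c b) = 1"
  by (cases c) (simp_all add: label_prob_def UNIV_bool field_simps)

lemma sample_prob_nonneg: "\<bar>\<delta>\<bar> \<le> 1 \<Longrightarrow> 0 \<le> sample_prob k \<delta> \<sigma> z"
  by (simp add: sample_prob_def label_prob_nonneg)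

lemma sum_sample_prob:
  "(\<Sum>z\<in>{..<k} \<times> UNIV. sample_prob k \<delta> \<sigma> z * f z)
     = (\<Sum>j<k. \<Sum>b\<in>UNIV. label_prob \<delta> (\<sigma> j) b * f (j, b)) / real k"
  by (simp add: sample_prob_def sum_divide_distrib flip: sum.cartesian_product')
     (simp add: sum.cartesian_product' flip: sum_divide_distrib)

lemma sum_sample_prob_1: "k > 0 \<Longrightarrow> (\<Sum>z\<in>{..<k} \<times> UNIV. sample_prob k \<delta> \<sigma> z) = 1"
  using sum_sample_prob[of k \<delta> \<sigma> "\<lambda>_. 1"] by (simp add: sum_label_prob)

text \<open>Le Cam's inequality between total variation and Hellinger affinity: factor
  \<open>p y - r y\<close> as a difference of squares of roots and apply Cauchy-Schwarz.\<close>

lemma sum_min_ge_affinity: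
  fixes p r :: "'b \<Rightarrow> real"
  assumes "\<And>y. y \<in> S \<Longrightarrow> 0 \<le> p y" "\<And>y. y \<in> S \<Longrightarrow> 0 \<le> r y"
    and "sum p S = 1" "sum r S = 1"
  shows "1 - sqrt (1 - (\<Sum>y\<in>S. sqrt (p y * r y))\<^sup>2) \<le> (\<Sum>y\<in>S. min (p y) (r y))"
proof -
  define A where "A = (\<Sum>y\<in>S. sqrt (p y * r y))"
  have sq: "(sqrt (p y) - sqrt (r y))\<^sup>2 = p y + r y - 2 * sqrt (p y * r y)"
    "(sqrt (p y) + sqrt (r y))\<^sup>2 = p y + r y + 2 * sqrt (p y * r y)" if "y \<in> S" for y
    using assms(1,2)[OF that] by (simp_all add: power2_eq_square algebra_simps real_sqrt_mult)
  have abs: "\<bar>p y - r y\<bar> = \<bar>sqrt (p y) - sqrt (r y)\<bar> * (sqrt (p y) + sqrt (r y))" if "y \<in> S" for y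
  proof -
    have "p y - r y = (sqrt (p y) - sqrt (r y)) * (sqrt (p y) + sqrt (r y))"
      using assms(1,2)[OF that] by (simp add: algebra_simps)
    then show ?thesis
      using assms(1,2)[OF that] by (simp add: abs_mult)
  qed
  have "(\<Sum>y\<in>S. \<bar>p y - r y\<bar>)\<^sup>2 
      = (\<Sum>y\<in>S. \<bar>sqrt (p y) - sqrt (r y)\<bar> * (sqrt (p y) + sqrt (r y)))\<^sup>2"
    by (simp add: abs)
  also have "\<dots> \<le> (\<Sum>y\<in>S. \<bar>sqrt (p y) - sqrt (r y)\<bar>\<^sup>2) * (\<Sum>y\<in>S. (sqrt (p y) + sqrt (r y))\<^sup>2)"
    by (rule Cauchy_Schwarz_ineq_sum)
  \<comment> \<open>Expanding the squares, both densities sum to 1 and the cross terms sum to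
    \<open>2 * A\<close>.\<close>
  also have "\<dots> = (2 - 2 * A) * (2 + 2 * A)"
    by (simp add: sq sum.distrib sum_subtractf assms A_def flip: sum_distrib_left)
  also have "\<dots> = 2\<^sup>2 * (1 - A\<^sup>2)"
    by (simp add: power2_eq_square algebra_simps)
  finally have "(\<Sum>y\<in>S. \<bar>p y - r y\<bar>) \<le> sqrt (2\<^sup>2 * (1 - A\<^sup>2))"
    by (rule real_le_rsqrt)
  also have "\<dots> = 2 * sqrt (1 - A\<^sup>2)"
    by (subst real_sqrt_mult) simp
  finally have tv: "(\<Sum>y\<in>S. \<bar>p y - r y\<bar>) \<le> 2 * sqrt (1 - A\<^sup>2)" .
  have "(\<Sum>y\<in>S. min (p y) (r y)) = (\<Sum>y\<in>S. (p y + r y - \<bar>p y - r y\<bar>) / 2)"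
    by (intro sum.cong) auto
  also have "\<dots> = 1 - (\<Sum>y\<in>S. \<bar>p y - r y\<bar>) / 2"
    by (simp add: sum.distrib sum_subtractf assms flip: sum_divide_distrib)
  finally show ?thesis
    using tv by (simp add: A_def)
qed

lemma sum_PiE_Times:
  "(\<Sum>z\<in>I \<rightarrow>\<^sub>E A \<times> C. f z) = (\<Sum>x\<in>I \<rightarrow>\<^sub>E A. \<Sum>y\<in>I \<rightarrow>\<^sub>E C. f (\<lambda>i\<in>I. (x i, y i)))"
proof -
  have "(\<Sum>z\<in>I \<rightarrow>\<^sub>E A \<times> C. f z)
      = (\<Sum>(x, y)\<in>(I \<rightarrow>\<^sub>E A) \<times> (I \<rightarrow>\<^sub>E C). f (\<lambda>i\<in>I. (x i, y i)))"
    by (rule sum.reindex_bij_witness[of _ "\<lambda>(x, y). \<lambda>i\<in>I. (x i, y i)"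
          "\<lambda>z. (\<lambda>i\<in>I. fst (z i), \<lambda>i\<in>I. snd (z i))"])
       (force simp: PiE_iff restrict_def extensional_def fun_eq_iff mem_Times_iff
         intro!: arg_cong[where f = f])+
  then show ?thesis
    by (simp add: sum.cartesian_product)
qed

text \<open>Given the inputs, the labels are independent, so the affinity is a product. Flipping
  \<open>\<sigma>\<close> at \<open>j\<close> changes only the factors with \<open>x i = j\<close>,
  each of which becomes \<open>sqrt (1 - \<delta>\<^sup>2)\<close>; the Weierstrass inequality
  bounds the squared product from below.\<close>

lemma label_overlap:
  assumes "finite I" and "\<bar>\<delta>\<bar> \<le> 1"
  shows "3 / 4 - real (card {i \<in> I. x i = j}) * \<delta>\<^sup>2
     \<le> (\<Sum>y\<in>I \<rightarrow>\<^sub>E UNIV. min (\<Prod>i\<in>I. label_prob \<delta> (\<sigma> (x i)) (y i))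
                          (\<Prod>i\<in>I. label_prob \<delta> ((\<sigma>(j := \<not> \<sigma> j)) (x i)) (y i)))"
    (is "_ \<le> (\<Sum>y\<in>?Y. min (?p y) (?r y))")
proof -
  define N where "N = real (card {i \<in> I. x i = j})"
  have d2: "\<delta>\<^sup>2 \<le> 1"
    using assms(2) by (simp add: abs_square_le_1)
  have aff: "(\<Sum>b\<in>UNIV. sqrt (label_prob \<delta> (\<sigma> l) b * label_prob \<delta> ((\<sigma>(j := \<not> \<sigma> j)) l) b))
      = sqrt (1 - (if l = j then \<delta>\<^sup>2 else 0))" for l
  proof (cases "l = j")
    case True
    have "(1 - \<delta>) * (1 + \<delta>) = 1 - \<delta>\<^sup>2"
      by (simp add: algebra_simps power2_eq_square)
    then have "sqrt ((1 - \<delta>) / 2 * ((1 + \<delta>) / 2)) = sqrt (1 - \<delta>\<^sup>2) / 2"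
      using real_sqrt_divide[of "(1 - \<delta>) * (1 + \<delta>)" 4] by simp
    then show ?thesis
      using True by (cases "\<sigma> j") (simp_all add: label_prob_def UNIV_bool mult.commute)
  next
    case False
    then show ?thesis
      using assms(2) sum_label_prob[of \<delta> "\<sigma> l"] by (simp add: label_prob_nonneg)
  qed
  have sqrt_prod: "sqrt (\<Prod>i\<in>I. f i) = (\<Prod>i\<in>I. sqrt (f i))" for f
    by (induction I rule: infinite_finite_induct) (simp_all add: real_sqrt_mult)
  have "(\<Sum>y\<in>?Y. sqrt (?p y * ?r y))
      = (\<Sum>y\<in>?Y. \<Prod>i\<in>I. sqrt (label_prob \<delta> (\<sigma> (x i)) (y i)
                               * label_prob \<delta> ((\<sigma>(j := \<not> \<sigma> j)) (x i)) (y i)))"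
    by (simp add: real_sqrt_mult sqrt_prod prod.distrib)
  also have "\<dots> = (\<Prod>i\<in>I. sqrt (1 - (if x i = j then \<delta>\<^sup>2 else 0)))"
    using assms(1) by (subst prod_sum_PiE[symmetric]) (simp_all only: aff finite)
  finally have "(\<Sum>y\<in>?Y. sqrt (?p y * ?r y))\<^sup>2
      = (\<Prod>i\<in>I. 1 - (if x i = j then \<delta>\<^sup>2 else 0))"
    using d2 by (simp add: prod_power_distrib)
  moreover have "1 - (\<Sum>i\<in>I. if x i = j then \<delta>\<^sup>2 else 0)
      \<le> (\<Prod>i\<in>I. 1 - (if x i = j then \<delta>\<^sup>2 else 0))"
    using d2 by (intro Weierstrass_prod_ineq) auto
  moreover have "(\<Sum>i\<in>I. if x i = j then \<delta>\<^sup>2 else 0) = N * \<delta>\<^sup>2"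
    using assms(1) by (simp add: N_def flip: sum.inter_filter)
  ultimately have A: "1 - N * \<delta>\<^sup>2 \<le> (\<Sum>y\<in>?Y. sqrt (?p y * ?r y))\<^sup>2"
    by simp
  have sum1: "(\<Sum>y\<in>?Y. \<Prod>i\<in>I. label_prob \<delta> (\<tau> (x i)) (y i)) = 1" for \<tau>
    using assms(1) by (subst prod_sum_PiE[symmetric]) (simp_all add: sum_label_prob)
  have "1 - sqrt (1 - (\<Sum>y\<in>?Y. sqrt (?p y * ?r y))\<^sup>2) \<le> (\<Sum>y\<in>?Y. min (?p y) (?r y))"
    using assms(2) by (intro sum_min_ge_affinity sum1 prod_nonneg ballI label_prob_nonneg) auto
  moreover have "sqrt (1 - (\<Sum>y\<in>?Y. sqrt (?p y * ?r y))\<^sup>2) \<le> sqrt (N * \<delta>\<^sup>2)"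
    using A by simp
  \<comment> \<open>The arithmetic-geometric mean inequality makes the bound linear in
    \<open>N\<close>, so that only the mean of \<open>N\<close> matters when the inputs are averaged
    out.\<close>
  moreover have "sqrt (N * \<delta>\<^sup>2) \<le> 1 / 4 + N * \<delta>\<^sup>2"
    using arith_geo_mean_sqrt[of "N * \<delta>\<^sup>2" "1 / 4"]
      real_sqrt_divide[of "N * \<delta>\<^sup>2" 4] by (simp add: N_def)
  ultimately show ?thesis
    unfolding N_def by linarith
qed

text \<open>Averages \<open>label_overlap\<close> over uniform inputs: the number of hits of
  \<open>j\<close> has mean \<open>card I / k\<close>, so at most \<open>1 / 4\<close> is lost from
  \<open>3 / 4\<close>.\<close>

lemma sample_overlap:
  assumes "finite I" and "\<bar>\<delta>\<bar> \<le> 1" and "j < k" and "4 * real (card I) * \<delta>\<^sup>2 \<le> real k"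
  shows "1 / 2 \<le> (\<Sum>z\<in>I \<rightarrow>\<^sub>E {..<k} \<times> UNIV.
     min (\<Prod>i\<in>I. sample_prob k \<delta> \<sigma> (z i)) (\<Prod>i\<in>I. sample_prob k \<delta> (\<sigma>(j := \<not> \<sigma> j)) (z i)))"
proof -
  \<comment> \<open>The probability of any single tuple of inputs.\<close>
  define w where "w = (1 / real k) ^ card I"
  have w: "0 \<le> w" and k: "0 < k"
    using assms(3) by (auto simp: w_def)
  have count: "(\<Sum>x\<in>I \<rightarrow>\<^sub>E {..<k}. w * real (card {i \<in> I. x i = j})) = card I / k"
  proof -
    have eq: "(\<Sum>x\<in>I \<rightarrow>\<^sub>E {..<k}. w * (if x i = j then 1 else 0)) = 1 / k" if "i \<in> I" for i
    proof -
      \<comment> \<open>The indicator is written as a product over all coordinates, so that the sum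
        over tuples factorizes: coordinate \<open>i\<close> contributes \<open>1 / k\<close> and
        every other one contributes 1.\<close>
      have "w * (if x i = j then 1 else 0)
          = (\<Prod>l\<in>I. (if l = i then (if x l = j then 1 else 0) else 1) / real k)" for x
        using assms(1) that by (simp add: w_def prod_dividef power_one_over)
      then have "(\<Sum>x\<in>I \<rightarrow>\<^sub>E {..<k}. w * (if x i = j then 1 else 0))
          = (\<Prod>l\<in>I. \<Sum>a<k. (if l = i then (if a = j then 1 else 0) else 1) / real k)"
        using assms(1) by (subst prod_sum_PiE) simp_all
      also have "\<dots> = (\<Prod>l\<in>I. if l = i then 1 / k else 1)"
        using assms(3) by (intro prod.cong) (auto simp flip: sum_divide_distrib)
      also have "\<dots> = 1 / k"
        using assms(1) that by simp
      finally show ?thesis .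
    qed
    have "(\<Sum>x\<in>I \<rightarrow>\<^sub>E {..<k}. w * real (card {i \<in> I. x i = j}))
        = (\<Sum>x\<in>I \<rightarrow>\<^sub>E {..<k}. \<Sum>i\<in>I. w * (if x i = j then 1 else 0))"
      using assms(1) by (simp add: sum.inter_filter[symmetric] flip: sum_distrib_left)
    also have "\<dots> = (\<Sum>i\<in>I. 1 / k)"
      by (subst sum.swap) (simp add: eq cong: sum.cong)
    finally show ?thesis by simp
  qed
  have total: "(\<Sum>x\<in>I \<rightarrow>\<^sub>E {..<k}. w) = 1"
    using k assms(1) prod_sum_PiE[of I "\<lambda>_. {..<k}" "\<lambda>_ _. 1 / real k"]
    by (simp add: w_def)
  have split: "(\<Prod>i\<in>I. sample_prob k \<delta> \<tau> ((\<lambda>i\<in>I. (x i, y i)) i))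
      = w * (\<Prod>i\<in>I. label_prob \<delta> (\<tau> (x i)) (y i))" for \<tau> x y
    by (simp add: sample_prob_def prod_dividef w_def power_one_over)
  have "1 / 2 \<le> 3 / 4 - card I / k * \<delta>\<^sup>2"
    using assms(4) k by (simp add: field_simps)
  also have "\<dots> = (\<Sum>x\<in>I \<rightarrow>\<^sub>E {..<k}. w * (3 / 4 - card {i \<in> I. x i = j} * \<delta>\<^sup>2))"
    unfolding right_diff_distrib sum_subtractf count[symmetric] sum_distrib_right
    using total by (simp add: mult.assoc flip: sum_distrib_right)
  also have "\<dots> \<le> (\<Sum>x\<in>I \<rightarrow>\<^sub>E {..<k}. w * (\<Sum>y\<in>I \<rightarrow>\<^sub>E UNIV.
      min (\<Prod>i\<in>I. label_prob \<delta> (\<sigma> (x i)) (y i))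
          (\<Prod>i\<in>I. label_prob \<delta> ((\<sigma>(j := \<not> \<sigma> j)) (x i)) (y i))))"
    using w assms(1,2) by (intro sum_mono mult_left_mono label_overlap)
  also have "\<dots> = (\<Sum>z\<in>I \<rightarrow>\<^sub>E {..<k} \<times> UNIV.
     min (\<Prod>i\<in>I. sample_prob k \<delta> \<sigma> (z i)) (\<Prod>i\<in>I. sample_prob k \<delta> (\<sigma>(j := \<not> \<sigma> j)) (z i)))"
    unfolding sum_PiE_Times split using w by (simp add: sum_distrib_left min_mult_distrib_left)
  finally show ?thesis .
qed

text \<open>An Assouad argument. Here \<open>r z j c\<close> stands for the risk, at point
  \<open>j\<close> with favoured sign \<open>c\<close>, of what is learned from the sample
  \<open>z\<close>. No single value of \<open>z\<close> can serve both signs well, and two patterns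
  that differ only at \<open>j\<close> give samples that overlap by at least one half.\<close>

lemma exists_hypercube_bayes:
  fixes r :: "(nat \<Rightarrow> nat \<times> bool) \<Rightarrow> nat \<Rightarrow> bool \<Rightarrow> real"
  assumes "finite I" and "\<bar>\<delta>\<bar> \<le> 1" and "0 < k" and "4 * real (card I) * \<delta>\<^sup>2 \<le> real k"
    and L: "\<And>z j c. z \<in> I \<rightarrow>\<^sub>E {..<k} \<times> UNIV \<Longrightarrow> j < k \<Longrightarrow> L \<le> r z j c"
    and M: "\<And>z j c. z \<in> I \<rightarrow>\<^sub>E {..<k} \<times> UNIV \<Longrightarrow> j < k \<Longrightarrow> 2 * M \<le> r z j c + r z j (\<not> c)"
    and "L \<le> M"
  shows "\<exists>\<sigma>. (L + M) / 2 \<le> (\<Sum>z\<in>I \<rightarrow>\<^sub>E {..<k} \<times> UNIV.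
     (\<Prod>i\<in>I. sample_prob k \<delta> \<sigma> (z i)) * ((\<Sum>j<k. r z j (\<sigma> j)) / real k))"
proof -
  define S :: "(nat \<Rightarrow> bool) set" where "S = {..<k} \<rightarrow>\<^sub>E UNIV"
  define Z :: "(nat \<Rightarrow> nat \<times> bool) set" where "Z = I \<rightarrow>\<^sub>E {..<k} \<times> UNIV"
  define w where "w = (\<lambda>\<sigma> z. \<Prod>i\<in>I. sample_prob k \<delta> \<sigma> (z i))"
  define flip :: "nat \<Rightarrow> (nat \<Rightarrow> bool) \<Rightarrow> nat \<Rightarrow> bool" where "flip = (\<lambda>j \<sigma>. \<sigma>(j := \<not> \<sigma> j))"
  have S: "finite S" "S \<noteq> {}"
    by (auto simp: S_def finite_PiE PiE_eq_empty_iff)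
  have w1: "sum (w \<sigma>) Z = 1" for \<sigma>
    using assms(1,3) unfolding w_def Z_def
    by (subst prod_sum_PiE[symmetric]) (simp_all add: sum_sample_prob_1)
  have w0: "0 \<le> w \<sigma> z" for \<sigma> z
    using assms(2) by (simp add: w_def prod_nonneg sample_prob_nonneg)
  have pair: "L + M \<le> (\<Sum>z\<in>Z. w \<sigma> z * r z j (\<sigma> j)) + (\<Sum>z\<in>Z. w (flip j \<sigma>) z * r z j (flip j \<sigma> j))"
    if j: "j < k" for j \<sigma>
  proof -
    have "1 / 2 \<le> (\<Sum>z\<in>Z. min (w \<sigma> z) (w (flip j \<sigma>) z))"
      unfolding Z_def w_def flip_def by (rule sample_overlap[OF assms(1,2) j assms(4)])
    then have "L + M \<le> 2 * L + 2 * (M - L) * (\<Sum>z\<in>Z. min (w \<sigma> z) (w (flip j \<sigma>) z))"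
      using mult_left_mono[of "1 / 2" _ "2 * (M - L)"] \<open>L \<le> M\<close> by fastforce
    also have "\<dots> = (\<Sum>z\<in>Z. (w \<sigma> z + w (flip j \<sigma>) z) * L
        + min (w \<sigma> z) (w (flip j \<sigma>) z) * (2 * (M - L)))"
      by (simp add: sum.distrib w1 flip: sum_distrib_right)
    also have "\<dots> \<le> (\<Sum>z\<in>Z. w \<sigma> z * r z j (\<sigma> j) + w (flip j \<sigma>) z * r z j (flip j \<sigma> j))"
    proof (rule sum_mono)
      fix z assume z: "z \<in> Z"
      define m where "m = min (w \<sigma> z) (w (flip j \<sigma>) z)"
      have "m * (2 * (M - L)) \<le> m * ((r z j (\<sigma> j) - L) + (r z j (flip j \<sigma> j) - L))"
        using M[of z j "\<sigma> j"] z j w0 by (intro mult_left_mono) (auto simp: m_def Z_def flip_def)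
      also have "\<dots> = m * (r z j (\<sigma> j) - L) + m * (r z j (flip j \<sigma> j) - L)"
        by (rule distrib_left)
      also have "\<dots> \<le> w \<sigma> z * (r z j (\<sigma> j) - L) + w (flip j \<sigma>) z * (r z j (flip j \<sigma> j) - L)"
        using L z j by (intro add_mono mult_right_mono) (auto simp: m_def Z_def)
      finally show "(w \<sigma> z + w (flip j \<sigma>) z) * L
          + min (w \<sigma> z) (w (flip j \<sigma>) z) * (2 * (M - L))
        \<le> w \<sigma> z * r z j (\<sigma> j) + w (flip j \<sigma>) z * r z j (flip j \<sigma> j)"
        by (simp add: m_def algebra_simps)
    qed
    finally show ?thesis
      by (simp add: sum.distrib)
  qed
  have coord: "real (card S) * ((L + M) / 2) \<le> (\<Sum>\<sigma>\<in>S. \<Sum>z\<in>Z. w \<sigma> z * r z j (\<sigma> j))" 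
    (is "_ \<le> sum ?f S") if j: "j < k" for j
  proof -
    \<comment> \<open>Flipping coordinate \<open>j\<close> is an involution of \<open>S\<close>, so
      the bound for pairs passes to the average over \<open>S\<close>.\<close>
    have "sum ?f S = (\<Sum>\<sigma>\<in>S. ?f (flip j \<sigma>))"
      using j by (intro sum.reindex_bij_witness[of _ "flip j" "flip j"])
        (auto simp: S_def flip_def PiE_iff extensional_def)
    then have "2 * sum ?f S = (\<Sum>\<sigma>\<in>S. ?f \<sigma> + ?f (flip j \<sigma>))"
      by (simp add: sum.distrib)
    moreover have "real (card S) * (L + M) \<le> (\<Sum>\<sigma>\<in>S. ?f \<sigma> + ?f (flip j \<sigma>))"
      using pair[OF j] by (intro sum_bounded_below) auto
    ultimately show ?thesis by simp
  qed
  \<comment> \<open>Some pattern is at least as bad as the average over all patterns.\<close>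
  have "\<exists>\<sigma>\<in>S. (L + M) / 2 \<le> (\<Sum>z\<in>Z. w \<sigma> z * ((\<Sum>j<k. r z j (\<sigma> j)) / real k))"
  proof (rule ccontr)
    assume "\<not> ?thesis"
    then have "(\<Sum>\<sigma>\<in>S. \<Sum>z\<in>Z. w \<sigma> z * ((\<Sum>j<k. r z j (\<sigma> j)) / real k)) < (\<Sum>\<sigma>\<in>S. (L + M) / 2)"
      using S by (intro sum_strict_mono) (auto simp: not_le)
    also have "\<dots> = (\<Sum>j<k. real (card S) * ((L + M) / 2)) / real k"
      using assms(3) by simp
    also have "\<dots> \<le> (\<Sum>j<k. \<Sum>\<sigma>\<in>S. \<Sum>z\<in>Z. w \<sigma> z * r z j (\<sigma> j)) / real k"
      using coord by (intro divide_right_mono sum_mono) auto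
    also have "\<dots> = (\<Sum>\<sigma>\<in>S. \<Sum>j<k. \<Sum>z\<in>Z. w \<sigma> z * r z j (\<sigma> j)) / real k"
      by (subst sum.swap) (rule refl)
    also have "\<dots> = (\<Sum>\<sigma>\<in>S. \<Sum>z\<in>Z. \<Sum>j<k. w \<sigma> z * r z j (\<sigma> j)) / real k"
      by (subst (2) sum.swap) (rule refl)
    also have "\<dots> = (\<Sum>\<sigma>\<in>S. \<Sum>z\<in>Z. w \<sigma> z * ((\<Sum>j<k. r z j (\<sigma> j)) / real k))"
      by (simp add: sum_distrib_left sum_divide_distrib)
    finally show False by simp
  qed
  then show ?thesis
    unfolding w_def Z_def by blast
qed

section \<open>Conditional risk\<close>

definition label_loss :: "real \<Rightarrow> real \<Rightarrow> bool \<Rightarrow> real \<Rightarrow> real" where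
  "label_loss B q b y = \<bar>(if b then B else - B) - y\<bar> powr q"

definition cond_risk :: "real \<Rightarrow> real \<Rightarrow> real \<Rightarrow> bool \<Rightarrow> real \<Rightarrow> real" where
  "cond_risk B q \<delta> c y = (\<Sum>b\<in>UNIV. label_prob \<delta> c b * label_loss B q b y)"

lemma cond_risk_Not: "cond_risk B q \<delta> (\<not> c) y = cond_risk B q \<delta> c (- y)"
proof -
  have "\<bar>- B - y\<bar> = \<bar>B + y\<bar>" "\<bar>y - B\<bar> = \<bar>B - y\<bar>"
    by linarith+
  then show ?thesis
    by (cases c) (simp_all add: cond_risk_def UNIV_bool label_prob_def label_loss_def)
qed

text \<open>Young's inequality for \<open>t powr q\<close> and 1 with weights \<open>1 / q\<close>
  and \<open>1 - 1 / q\<close>, multiplied by \<open>q\<close>.\<close>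

lemma Bernoulli_powr:
  fixes t q :: real
  assumes "0 \<le> t" and "1 \<le> q"
  shows "1 + q * (t - 1) \<le> t powr q"
proof -
  have "(t powr q) powr (1 / q) * 1 powr (1 - 1 / q) \<le> 1 / q * t powr q + (1 - 1 / q) * 1"
  proof (cases "t = 0")
    case False
    then show ?thesis
      using assms by (intro Youngs_inequality_0) auto
  qed (use assms in auto)
  also have "(t powr q) powr (1 / q) * 1 powr (1 - 1 / q) = t"
    using assms by (simp add: powr_powr)
  finally have "q * t \<le> q * (1 / q * t powr q + (1 - 1 / q) * 1)"
    using assms(2) by (intro mult_left_mono) auto
  also have "\<dots> = t powr q + q - 1"
    using assms(2) by (simp add: algebra_simps)
  finally show ?thesis
    by (simp add: algebra_simps)
qed

text \<open>Adding the two signs cancels \<open>\<delta>\<close> and leaves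
  \<open>(B - y) powr q + (B + y) powr q\<close>. Each term lies above its tangent at
  \<open>y = 0\<close>, and the slopes cancel.\<close>

lemma cond_risk_add_Not:
  assumes "B > 0" and "1 \<le> q" and "\<bar>y\<bar> \<le> B"
  shows "2 * B powr q \<le> cond_risk B q \<delta> c y + cond_risk B q \<delta> (\<not> c) y"
proof -
  have ge: "B powr q * (1 - q * (u / B)) \<le> (B - u) powr q" if "\<bar>u\<bar> \<le> B" for u
  proof -
    have "1 - q * (u / B) \<le> (1 - u / B) powr q"
      using Bernoulli_powr[of "1 - u / B" q] that assms by simp
    then have "B powr q * (1 - q * (u / B)) \<le> B powr q * (1 - u / B) powr q"
      by (rule mult_left_mono) simp
    also have "\<dots> = (B * (1 - u / B)) powr q"
      using that assms by (subst powr_mult) auto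
    finally show ?thesis
      using assms by (simp add: right_diff_distrib)
  qed
  have "\<bar>B - y\<bar> = B - y" "\<bar>- B - y\<bar> = B - - y"
    using assms(3) by auto
  then have "cond_risk B q \<delta> c y + cond_risk B q \<delta> (\<not> c) y = (B - y) powr q + (B - - y) powr q"
    by (cases c) (simp_all add: cond_risk_def UNIV_bool label_prob_def label_loss_def field_simps)
  moreover have "2 * B powr q = B powr q * (1 - q * (y / B)) + B powr q * (1 - q * (- y / B))"
    by (simp add: algebra_simps)
  ultimately show ?thesis
    using ge[of y] ge[of "- y"] assms(3) by simp
qed

text \<open>Bounds the optimal conditional risk by a test prediction: \<open>B\<close> for
  \<open>q = 1\<close>, where equality holds, and \<open>B / 2\<close> for \<open>q > 1\<close>,
  where the two losses are \<open>1 / 2\<close> and \<open>3 / 2\<close> to the power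
  \<open>q\<close>, times \<open>B powr q\<close>.\<close>

lemma cond_risk_gap:
  assumes "B > 0" and "1 \<le> q" and "q \<le> 1 + \<delta>" and "0 \<le> \<delta>" and "\<delta> \<le> 1"
  shows "\<exists>y. \<bar>y\<bar> \<le> B \<and> cond_risk B q \<delta> True y \<le> (1 - 4 * c_const q * \<delta>) * B powr q"
proof (cases "q = 1")
  case True
  then have "cond_risk B q \<delta> True B = (1 - 4 * c_const q * \<delta>) * B powr q"
    using assms by (simp add: cond_risk_def UNIV_bool label_prob_def label_loss_def c_const_def)
  then show ?thesis
    using assms(1) by (intro exI[of _ B]) auto
next
  case False
  have half: "\<bar>B - B / 2\<bar> = 1 / 2 * B" "\<bar>- B - B / 2\<bar> = 3 / 2 * B"
    using assms(1) by auto
  \<comment> \<open>Weighted means give \<open>(3 / 2) powr \<delta> \<le> 1 + \<delta> / 2\<close>,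
    which controls the larger loss because \<open>q \<le> 1 + \<delta>\<close>.\<close>
  have "(3 / 2 :: real) powr \<delta> * 1 powr (1 - \<delta>) \<le> \<delta> * (3 / 2) + (1 - \<delta>) * 1"
    using assms by (intro Youngs_inequality_0) auto
  then have "(3 / 2 :: real) powr (1 + \<delta>) \<le> 3 / 2 * (1 + \<delta> / 2)"
    by (simp add: powr_add field_simps)
  then have b: "(3 / 2 :: real) powr q \<le> 3 / 2 * (1 + \<delta> / 2)"
    using powr_mono[of q "1 + \<delta>" "3 / 2 :: real"] assms(3) by linarith
  have a: "(1 / 2 :: real) powr q \<le> 1 / 2"
    using powr_mono'[of 1 q "1 / 2 :: real"] assms(2) by simp
  have "(1 + \<delta>) / 2 * (1 / 2) powr q + (1 - \<delta>) / 2 * (3 / 2) powr q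
      \<le> (1 + \<delta>) / 2 * (1 / 2) + (1 - \<delta>) / 2 * (3 / 2 * (1 + \<delta> / 2))"
    using a b assms by (intro add_mono mult_left_mono) auto
  \<comment> \<open>The left side equals
    \<open>1 - \<delta> / 8 - 3 * \<delta>\<^sup>2 / 8\<close>.\<close>
  also have "\<dots> \<le> 1 - (1 + \<delta>) / 10 * \<delta>"
    using zero_le_square[of \<delta>] assms(4) by (simp add: field_simps)
  \<comment> \<open>Here \<open>4 * c_const q = q / 10\<close> and
    \<open>q \<le> 1 + \<delta>\<close>.\<close>
  also have "\<dots> \<le> 1 - 4 * c_const q * \<delta>"
    using False assms by (simp add: c_const_def mult_right_mono)
  finally have "((1 + \<delta>) / 2 * (1 / 2) powr q + (1 - \<delta>) / 2 * (3 / 2) powr q) * B powr q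
      \<le> (1 - 4 * c_const q * \<delta>) * B powr q"
    by (rule mult_right_mono) simp
  moreover have "cond_risk B q \<delta> True (B / 2)
      = ((1 + \<delta>) / 2 * (1 / 2) powr q + (1 - \<delta>) / 2 * (3 / 2) powr q) * B powr q"
  proof -
    have "cond_risk B q \<delta> True (B / 2)
        = (1 + \<delta>) / 2 * \<bar>B - B / 2\<bar> powr q + (1 - \<delta>) / 2 * \<bar>- B - B / 2\<bar> powr q"
      by (simp add: cond_risk_def UNIV_bool label_loss_def label_prob_def)
    also have "\<dots> = (1 + \<delta>) / 2 * ((1 / 2) powr q * B powr q)
        + (1 - \<delta>) / 2 * ((3 / 2) powr q * B powr q)"
      unfolding half using assms(1) by (subst (1 2) powr_mult) simp_all
    finally show ?thesis
      by (simp only: distrib_right mult.assoc)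
  qed
  ultimately show ?thesis
    using assms(1) by (intro exI[of _ "B / 2"]) auto
qed

text \<open>Continuity on a compact interval. The minimizer \<open>u\<close> is the best prediction
  where \<open>True\<close> is favoured; by \<open>cond_risk_Not\<close>, \<open>- u\<close> is best
  where \<open>False\<close> is.\<close>

lemma cond_risk_minimizer:
  assumes "B > 0" and "1 \<le> q"
  shows "\<exists>u. \<bar>u\<bar> \<le> B \<and> (\<forall>y. \<bar>y\<bar> \<le> B \<longrightarrow> cond_risk B q \<delta> True u \<le> cond_risk B q \<delta> True y)"
proof -
  have "continuous_on {-B..B} (cond_risk B q \<delta> True)"
    unfolding cond_risk_def label_loss_def using assms(2)
    by (intro continuous_intros continuous_on_powr') auto
  then have "\<exists>u\<in>{-B..B}. \<forall>y\<in>{-B..B}. cond_risk B q \<delta> True u \<le> cond_risk B q \<delta> True y"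
    using assms(1) by (intro continuous_attains_inf) auto
  then show ?thesis
    by (auto simp: abs_le_iff)
qed

section \<open>Finitely supported distributions\<close>

text \<open>The two measures agree on measurable rectangles, which determines a product measure.
  This reduces the law of the training set to a discrete one.\<close>

lemma PiM_distr_pmf:
  assumes "finite I" and f: "range f \<subseteq> space M"
  shows "(\<Pi>\<^sub>M i\<in>I. distr (measure_pmf p) M f)
    = distr (measure_pmf (Pi_pmf I undefined (\<lambda>_. p))) (\<Pi>\<^sub>M i\<in>I. M) (\<lambda>z. \<lambda>i\<in>I. f (z i))"
    (is "?L = distr (measure_pmf ?P) ?M ?F")
proof (rule sym, rule product_sigma_finite.PiM_eqI)
  have fm: "f \<in> measurable (measure_pmf p) M"
    using f by (auto simp: measurable_def)
  interpret D: prob_space "distr (measure_pmf p) M f"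
    by (rule measure_pmf.prob_space_distr) (rule fm)
  show "product_sigma_finite (\<lambda>_. distr (measure_pmf p) M f)"
    by unfold_locales
  show "finite I" by fact
  show "sets (distr (measure_pmf ?P) ?M ?F) = sets (\<Pi>\<^sub>M i\<in>I. distr (measure_pmf p) M f)"
    by (simp cong: sets_PiM_cong)
  have Fm: "?F \<in> measurable (measure_pmf ?P) ?M"
    using f by (auto simp: measurable_def space_PiM)
  fix A assume "\<And>i. i \<in> I \<Longrightarrow> A i \<in> sets (distr (measure_pmf p) M f)"
  then have A: "\<And>i. i \<in> I \<Longrightarrow> A i \<in> sets M" by simp
  have "emeasure (distr (measure_pmf ?P) ?M ?F) (Pi\<^sub>E I A) = emeasure ?P (?F -` Pi\<^sub>E I A)"
    using A Fm assms(1) by (subst emeasure_distr) (auto intro!: sets_PiM_I_finite)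
  also have "?F -` Pi\<^sub>E I A = Pi I (\<lambda>i. f -` A i)"
    by (auto simp: PiE_iff Pi_iff)
  also have "emeasure ?P \<dots> = (\<Prod>i\<in>I. emeasure (measure_pmf p) (f -` A i))"
    using assms(1) by (simp add: measure_pmf.emeasure_eq_measure measure_Pi_pmf_Pi prod_ennreal)
  also have "\<dots> = (\<Prod>i\<in>I. emeasure (distr (measure_pmf p) M f) (A i))"
    using A fm by (intro prod.cong) (auto simp: emeasure_distr)
  finally show "emeasure (distr (measure_pmf ?P) ?M ?F) (Pi\<^sub>E I A)
      = (\<Prod>i\<in>I. emeasure (distr (measure_pmf p) M f) (A i))" .
qed

text \<open>\<open>S\<close> may exceed the support, so the same index set of the sum serves every
  \<open>\<sigma>\<close>, even for \<open>\<delta> = 1\<close>, where some labels have probability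
  0.\<close>

lemma integral_PiM_distr_pmf:
  fixes h :: "_ \<Rightarrow> real"
  assumes "finite I" and f: "range f \<subseteq> space M" and S: "finite S" "set_pmf p \<subseteq> S"
    and h: "h \<in> borel_measurable (\<Pi>\<^sub>M i\<in>I. M)"
  shows "(\<integral>Z. h Z \<partial>(\<Pi>\<^sub>M i\<in>I. distr (measure_pmf p) M f))
    = (\<Sum>z\<in>I \<rightarrow>\<^sub>E S. (\<Prod>i\<in>I. pmf p (z i)) * h (\<lambda>i\<in>I. f (z i)))"
proof -
  \<comment> \<open>The default value \<open>undefined\<close> makes the support consist of
    extensional tuples, as in \<open>I \<rightarrow>\<^sub>E S\<close>.\<close>
  let ?P = "Pi_pmf I undefined (\<lambda>_. p)"
  have "(\<lambda>z. \<lambda>i\<in>I. f (z i)) \<in> measurable (measure_pmf ?P) (\<Pi>\<^sub>M i\<in>I. M)"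
    using f by (auto simp: measurable_def space_PiM)
  then have "(\<integral>Z. h Z \<partial>(\<Pi>\<^sub>M i\<in>I. distr (measure_pmf p) M f))
      = (\<integral>z. h (\<lambda>i\<in>I. f (z i)) \<partial>measure_pmf ?P)"
    unfolding PiM_distr_pmf[OF assms(1) f] by (rule integral_distr) (rule h)
  also have "\<dots> = (\<Sum>z\<in>I \<rightarrow>\<^sub>E S. pmf ?P z *\<^sub>R h (\<lambda>i\<in>I. f (z i)))"
  proof (rule integral_measure_pmf)
    show "finite (I \<rightarrow>\<^sub>E S)"
      using assms(1) S(1) by (simp add: finite_PiE)
    fix z assume "z \<in> set_pmf ?P"
    then have "z \<in> PiE_dflt I undefined (set_pmf \<circ> (\<lambda>_. p))"
      by (simp only: set_Pi_pmf[OF assms(1)])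
    then show "z \<in> I \<rightarrow>\<^sub>E S"
      using S(2) by (auto simp: PiE_dflt_def PiE_iff extensional_def)
  qed
  also have "\<dots> = (\<Sum>z\<in>I \<rightarrow>\<^sub>E S. (\<Prod>i\<in>I. pmf p (z i)) * h (\<lambda>i\<in>I. f (z i)))"
  proof (rule sum.cong[OF refl])
    fix z assume z: "z \<in> I \<rightarrow>\<^sub>E S"
    have "pmf ?P z = (\<Prod>i\<in>I. pmf p (z i))"
      by (rule pmf_Pi'[OF assms(1)]) (rule PiE_arb[OF z])
    then show "pmf ?P z *\<^sub>R h (\<lambda>i\<in>I. f (z i)) = (\<Prod>i\<in>I. pmf p (z i)) * h (\<lambda>i\<in>I. f (z i))"
      by simp
  qed
  finally show ?thesis .
qed

lemma integral_distr_pmf: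
  fixes h :: "_ \<Rightarrow> real"
  assumes f: "range f \<subseteq> space M" and S: "finite S" "set_pmf p \<subseteq> S"
    and h: "h \<in> borel_measurable M"
  shows "(\<integral>z. h z \<partial>distr (measure_pmf p) M f) = (\<Sum>s\<in>S. pmf p s * h (f s))"
proof -
  have "(\<integral>z. h z \<partial>distr (measure_pmf p) M f) = (\<integral>s. h (f s) \<partial>measure_pmf p)"
    using f h by (intro integral_distr) (auto simp: measurable_def)
  also have "\<dots> = (\<Sum>s\<in>S. pmf p s *\<^sub>R h (f s))"
    using S by (intro integral_measure_pmf) auto
  finally show ?thesis by simp
qed

lemma exists_pmf_sample_prob:
  assumes "0 < k" and "\<bar>\<delta>\<bar> \<le> 1"
  shows "\<exists>p. set_pmf p \<subseteq> {..<k} \<times> UNIV \<and> (\<forall>z\<in>{..<k} \<times> UNIV. pmf p z = sample_prob k \<delta> \<sigma> z)"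
proof -
  let ?S = "{..<k} \<times> (UNIV :: bool set)"
  \<comment> \<open>\<open>sample_prob\<close> does not vanish at indices from \<open>k\<close> on,
    hence the cut-off.\<close>
  define f where "f = (\<lambda>z. if z \<in> ?S then sample_prob k \<delta> \<sigma> z else 0)"
  have nn: "0 \<le> f z" for z
    using assms(2) by (simp add: f_def sample_prob_nonneg)
  have "(\<integral>\<^sup>+z. ennreal (f z) \<partial>count_space UNIV) = (\<Sum>z\<in>?S. ennreal (f z))"
    by (rule nn_integral_count_space') (auto simp: f_def)
  also have "\<dots> = ennreal (\<Sum>z\<in>?S. f z)"
    using nn by (intro sum_ennreal) auto
  also have "(\<Sum>z\<in>?S. f z) = (\<Sum>z\<in>?S. sample_prob k \<delta> \<sigma> z)"
    by (intro sum.cong) (auto simp: f_def)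
  finally have one: "(\<integral>\<^sup>+z. ennreal (f z) \<partial>count_space UNIV) = 1"
    using assms(1) by (simp add: sum_sample_prob_1)
  show ?thesis
    using nn one by (intro exI[of _ "embed_pmf f"])
      (auto simp: set_embed_pmf pmf_embed_pmf f_def split: if_splits)
qed

section \<open>Losses and risks on the data space\<close>

lemma space_data_space: "space (data_space X B) = space X \<times> {-B..B}"
  by (simp add: data_space_def space_pair_measure)

lemma prediction_function_bound:
  "g \<in> prediction_functions X B \<Longrightarrow> x \<in> space X \<Longrightarrow> \<bar>g x\<bar> \<le> B"
  using measurable_space[of g X "label_space B" x] by (auto simp: prediction_functions_def)

lemma measurable_loss:
  assumes "g \<in> prediction_functions X B"
  shows "(\<lambda>z. \<bar>snd z - g (fst z)\<bar> powr q) \<in> borel_measurable (data_space X B)"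
proof -
  have "g \<in> measurable X (restrict_space borel {-B..B})"
    using assms by (simp add: prediction_functions_def label_space_def)
  then have g: "g \<in> borel_measurable X"
    by (simp add: measurable_restrict_space2_iff)
  have id: "(\<lambda>y. y) \<in> borel_measurable (label_space B)"
    unfolding label_space_def by (rule measurable_restrict_space1) simp
  show ?thesis
    unfolding data_space_def
    by (intro measurable_abs_powr borel_measurable_diff
        measurable_compose[OF measurable_snd id] measurable_compose[OF measurable_fst g])
qed

lemma distr_pmf_distributions:
  assumes "range f \<subseteq> space (data_space X B)"
  shows "distr (measure_pmf p) (data_space X B) f \<in> distributions X B"
proof -
  have "f \<in> measurable (measure_pmf p) (data_space X B)"
    using assms by (auto simp: measurable_def)
  then have "prob_space (distr (measure_pmf p) (data_space X B) f)"
    by (rule measure_pmf.prob_space_distr)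
  then show ?thesis
    by (simp add: distributions_def)
qed

definition cube_point :: "(nat \<Rightarrow> 'a) \<Rightarrow> real \<Rightarrow> nat \<times> bool \<Rightarrow> 'a \<times> real" where
  "cube_point x B = (\<lambda>(j, b). (x j, if b then B else - B))"

lemma range_cube_point:
  "0 \<le> B \<Longrightarrow> range x \<subseteq> space X \<Longrightarrow> range (cube_point x B) \<subseteq> space (data_space X B)"
  by (auto simp: cube_point_def space_data_space)

lemma risk_cube:
  assumes "0 \<le> B" and "range x \<subseteq> space X" and g: "g \<in> prediction_functions X B"
    and p: "set_pmf p \<subseteq> {..<k} \<times> UNIV" "\<forall>z\<in>{..<k} \<times> UNIV. pmf p z = sample_prob k \<delta> \<sigma> z"
  shows "risk q (distr (measure_pmf p) (data_space X B) (cube_point x B)) g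
    = (\<Sum>j<k. cond_risk B q \<delta> (\<sigma> j) (g (x j))) / real k"
proof -
  let ?l = "\<lambda>z. \<bar>snd z - g (fst z)\<bar> powr q"
  have "risk q (distr (measure_pmf p) (data_space X B) (cube_point x B)) g
      = (\<Sum>z\<in>{..<k} \<times> UNIV. pmf p z * ?l (cube_point x B z))"
    unfolding risk_def
    by (intro integral_distr_pmf range_cube_point assms measurable_loss finite_cartesian_product) auto
  also have "\<dots> = (\<Sum>z\<in>{..<k} \<times> UNIV. sample_prob k \<delta> \<sigma> z * ?l (cube_point x B z))"
    using p(2) by (intro sum.cong) auto
  finally show ?thesis
    by (simp add: sum_sample_prob cube_point_def cond_risk_def label_loss_def)
qed

section \<open>The lower bound\<close>

text \<open>The value \<open>u\<close> is fixed before the estimator, while \<open>P\<close> and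
  \<open>\<sigma>\<close> depend on it. The bound holds for every predictor that is optimal for
  \<open>\<sigma>\<close>, so a class with one optimal predictor per pattern can be fixed in
  advance.\<close>

lemma exists_hypercube_distribution:
  fixes x :: "nat \<Rightarrow> 'a"
  assumes "B > 0" and "1 \<le> q" and "q \<le> 1 + \<delta>" and "0 \<le> \<delta>" and "\<delta> \<le> 1"
    and "0 < k" and n: "4 * real n * \<delta>\<^sup>2 \<le> real k" and x: "range x \<subseteq> space X"
  shows "\<exists>u. \<bar>u\<bar> \<le> B \<and> (\<forall>ghat. estimator X B q n ghat \<longrightarrow>
    (\<exists>P\<in>distributions X B. \<exists>\<sigma>. \<forall>g\<in>prediction_functions X B.
      (\<forall>j<k. g (x j) = (if \<sigma> j then u else - u)) \<longrightarrow>
      2 * c_const q * \<delta> * B powr q \<le> expected_risk q n P ghat - risk q P g))"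
proof -
  obtain u where u: "\<bar>u\<bar> \<le> B"
    and min: "\<And>y. \<bar>y\<bar> \<le> B \<Longrightarrow> cond_risk B q \<delta> True u \<le> cond_risk B q \<delta> True y"
    using cond_risk_minimizer[OF assms(1,2)] by blast
  define L where "L = cond_risk B q \<delta> True u"
  define I where "I = {1..n}"
  have I: "finite I" "card I = n"
    by (auto simp: I_def)
  have L: "L \<le> cond_risk B q \<delta> c y" if "\<bar>y\<bar> \<le> B" for c y
    using min[of y] min[of "- y"] that cond_risk_Not[of B q \<delta> True y] by (cases c) (auto simp: L_def)
  have attained: "cond_risk B q \<delta> c (if c then u else - u) = L" for c
    using cond_risk_Not[of B q \<delta> True "- u"] by (cases c) (auto simp: L_def)
  have gap: "L \<le> (1 - 4 * c_const q * \<delta>) * B powr q"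
    using cond_risk_gap[OF assms(1-5)] L[of _ True] by (meson order_trans)
  have LM: "L \<le> B powr q"
  proof -
    have "0 \<le> 4 * c_const q * \<delta> * B powr q"
      using assms(2,4) by (simp add: c_const_def)
    then show ?thesis
      using gap by (simp only: left_diff_distrib)
  qed
  have "\<exists>P\<in>distributions X B. \<exists>\<sigma>. \<forall>g\<in>prediction_functions X B.
      (\<forall>j<k. g (x j) = (if \<sigma> j then u else - u)) \<longrightarrow>
      2 * c_const q * \<delta> * B powr q \<le> expected_risk q n P ghat - risk q P g"
    if est: "estimator X B q n ghat" for ghat
  proof -
    \<comment> \<open>The estimator as a function of the discrete sample of indices and
      signs.\<close>
    define gz where "gz = (\<lambda>z. ghat (\<lambda>i\<in>I. cube_point x B (z i)))"
    have cube: "range (cube_point x B) \<subseteq> space (data_space X B)"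
      using assms(1) x by (intro range_cube_point) auto
    have gz: "gz z \<in> prediction_functions X B" for z
    proof -
      have "(\<lambda>i\<in>I. cube_point x B (z i)) \<in> space (\<Pi>\<^sub>M i\<in>{1..n}. data_space X B)"
        using cube by (auto simp: space_PiM I_def)
      then show ?thesis
        using est unfolding estimator_def gz_def by blast
    qed
    have bound: "\<bar>gz z (x j)\<bar> \<le> B" for z j
      using x by (intro prediction_function_bound[OF gz]) auto
    \<comment> \<open>The hypercube bound with \<open>M = B powr q\<close>, which is admissible by
      \<open>cond_risk_add_Not\<close>.\<close>
    have "\<exists>\<sigma>. (L + B powr q) / 2 \<le> (\<Sum>z\<in>I \<rightarrow>\<^sub>E {..<k} \<times> UNIV.
      (\<Prod>i\<in>I. sample_prob k \<delta> \<sigma> (z i)) * ((\<Sum>j<k. cond_risk B q \<delta> (\<sigma> j) (gz z (x j))) / real k))"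
      using assms I LM
      by (intro exists_hypercube_bayes) (auto intro!: L bound cond_risk_add_Not)
    then obtain \<sigma> where \<sigma>: "(L + B powr q) / 2 \<le> (\<Sum>z\<in>I \<rightarrow>\<^sub>E {..<k} \<times> UNIV.
      (\<Prod>i\<in>I. sample_prob k \<delta> \<sigma> (z i)) * ((\<Sum>j<k. cond_risk B q \<delta> (\<sigma> j) (gz z (x j))) / real k))"
      by blast
    obtain p where p: "set_pmf p \<subseteq> {..<k} \<times> UNIV"
      "\<forall>z\<in>{..<k} \<times> UNIV. pmf p z = sample_prob k \<delta> \<sigma> z"
      using exists_pmf_sample_prob[of k \<delta> \<sigma>] assms by auto
    define P where "P = distr (measure_pmf p) (data_space X B) (cube_point x B)"
    have P: "P \<in> distributions X B"
      unfolding P_def by (rule distr_pmf_distributions[OF cube])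
    have risk: "risk q P g = (\<Sum>j<k. cond_risk B q \<delta> (\<sigma> j) (g (x j))) / real k"
      if "g \<in> prediction_functions X B" for g
      unfolding P_def using assms(1) by (intro risk_cube x that p) auto
    have meas: "(\<lambda>Z. risk q P (ghat Z)) \<in> borel_measurable (\<Pi>\<^sub>M i\<in>I. data_space X B)"
      using est P unfolding estimator_def I_def by blast
    have "expected_risk q n P ghat
        = (\<Sum>z\<in>I \<rightarrow>\<^sub>E {..<k} \<times> UNIV. (\<Prod>i\<in>I. pmf p (z i)) * risk q P (gz z))"
      unfolding expected_risk_def gz_def I_def[symmetric] using meas unfolding P_def
      by (intro integral_PiM_distr_pmf I cube p(1)) auto
    also have "\<dots> = (\<Sum>z\<in>I \<rightarrow>\<^sub>E {..<k} \<times> UNIV. (\<Prod>i\<in>I. sample_prob k \<delta> \<sigma> (z i))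
        * ((\<Sum>j<k. cond_risk B q \<delta> (\<sigma> j) (gz z (x j))) / real k))"
      using p(2) by (intro sum.cong arg_cong2[where f = "(*)"] prod.cong risk gz) (auto simp: PiE_iff)
    finally have lower: "(L + B powr q) / 2 \<le> expected_risk q n P ghat"
      using \<sigma> by simp
    \<comment> \<open>The optimal risk is \<open>L\<close>, so the excess is at least
      \<open>(B powr q - L) / 2\<close>, and \<open>gap\<close> bounds this.\<close>
    have "2 * c_const q * \<delta> * B powr q \<le> expected_risk q n P ghat - risk q P g"
      if g: "g \<in> prediction_functions X B" "\<forall>j<k. g (x j) = (if \<sigma> j then u else - u)" for g
    proof -
      have "risk q P g = L"
        using g(2) assms(6) by (simp add: risk[OF g(1)] attained)
      then show ?thesis
        using lower gap by (simp add: algebra_simps)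
    qed
    then show ?thesis
      using P by blast
  qed
  then show ?thesis
    using u by blast
qed

section \<open>Choice of the points, the degenerate case and the final assembly\<close>

lemma exists_points:
  assumes "A \<noteq> {}" and "finite A \<Longrightarrow> k \<le> card A"
  shows "\<exists>x :: nat \<Rightarrow> 'a. range x \<subseteq> A \<and> inj_on x {..<k}"
proof -
  have "\<exists>S. finite S \<and> card S = k \<and> S \<subseteq> A"
  proof (cases "finite A")
    case True
    then show ?thesis
      using obtain_subset_with_card_n[OF assms(2)] by metis
  next
    case False
    then show ?thesis
      using infinite_arbitrarily_large by metis
  qed
  then obtain S where S: "finite S" "card S = k" "S \<subseteq> A" by blast
  obtain h where h: "bij_betw h {..<k} S"
    using ex_bij_betw_nat_finite[OF S(1)] S(2) by (auto simp: atLeast0LessThan)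
  obtain a where "a \<in> A" using assms(1) by blast
  \<comment> \<open>Indices from \<open>k\<close> on go to an arbitrary point \<open>a\<close>,
    which keeps the total function inside \<open>A\<close>.\<close>
  then have "range (\<lambda>j. if j < k then h j else a) \<subseteq> A"
    using h S(3) by (auto simp: bij_betw_def)
  moreover have "inj_on (\<lambda>j. if j < k then h j else a) {..<k}"
    using h by (auto simp: bij_betw_def inj_on_def)
  ultimately show ?thesis by blast
qed

text \<open>A point mass on the graph of \<open>g\<close>. It settles the case in which the claimed
  bound is 0.\<close>

lemma exists_noiseless_distribution:
  assumes "g \<in> prediction_functions X B" and "space X \<noteq> {}"
  shows "\<exists>P\<in>distributions X B. risk q P g = 0"
proof -
  obtain a where a: "a \<in> space X" using assms(2) by blast
  define f where "f = (\<lambda>_ :: unit. (a, g a))"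
  have f: "range f \<subseteq> space (data_space X B)"
    using prediction_function_bound[OF assms(1) a] a by (auto simp: f_def space_data_space)
  have "risk q (distr (measure_pmf (return_pmf ())) (data_space X B) f) g = 0"
    unfolding risk_def
    by (subst integral_distr_pmf[OF f, of "{()}"]) (auto simp: f_def intro!: measurable_loss assms(1))
  then show ?thesis
    using distr_pmf_distributions[OF f] by blast
qed

lemma expected_risk_nonneg: "0 \<le> expected_risk q n P ghat"
  by (auto simp: expected_risk_def risk_def intro!: integral_nonneg)

theorem theorem8p3:
  fixes B q :: real and d n :: nat and X :: "'a measure"
  assumes "B > 0" and "d \<ge> 1" and "n \<ge> 1"
    and "1 \<le> q"
    and "q \<le> 1 + sqrt (min (real_of_int \<lfloor>log 2 (real d)\<rfloor> / (4 * real n)) 1)"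
    and "space X \<noteq> {}" and "separates_points X"
    and "finite (space X) \<Longrightarrow> \<lfloor>log 2 (real d)\<rfloor> \<le> int (card (space X))"
  shows "\<exists>G. G \<subseteq> prediction_functions X B \<and> finite G \<and> card G = d \<and>
    (\<forall>ghat. estimator X B q n ghat \<longrightarrow>
      (\<exists>P \<in> distributions X B.
        expected_risk q n P ghat - (MIN g\<in>G. risk q P g) \<ge>
          (if card G < 2 ^ (4 * n + 1)
           then c_const q * B powr q * sqrt (real_of_int \<lfloor>log 2 (real (card G))\<rfloor> / real n)
           else 2 * c_const q * B powr q)))"
proof -
  define m where "m = nat \<lfloor>log 2 (real d)\<rfloor>"
  have floor: "\<lfloor>log 2 (real d)\<rfloor> = int m"
    using assms(2) by (simp add: m_def)
  then have d: "2 ^ m \<le> d" "d < 2 ^ (m + 1)"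
    using floor_log_nat_eq_powr_iff[of 2 d m] assms(2) by auto
  define thr where "thr = (if d < 2 ^ (4 * n + 1) then c_const q * B powr q * sqrt (real m / real n)
    else 2 * c_const q * B powr q)"
  \<comment> \<open>A bound against one member of \<open>G\<close> suffices, since the minimum over
    \<open>G\<close> is no larger than the risk of that member.\<close>
  have "\<exists>G. G \<subseteq> prediction_functions X B \<and> finite G \<and> card G = d \<and>
    (\<forall>ghat. estimator X B q n ghat \<longrightarrow>
      (\<exists>P\<in>distributions X B. \<exists>g\<in>G. thr \<le> expected_risk q n P ghat - risk q P g))"
  proof (cases "m = 0")
    case True
    \<comment> \<open>Here \<open>d = 1\<close> and the threshold is 0, so any class will do, with a
      distribution on which its member has no risk.\<close>
    obtain G where G: "G \<subseteq> prediction_functions X B" "finite G" "card G = d"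
      using exists_superset_with_card[OF infinite_prediction_functions[OF assms(1,6)], of "{}" d]
      by auto
    then obtain g where g: "g \<in> G"
      using assms(2) by fastforce
    obtain P where P: "P \<in> distributions X B" "risk q P g = 0"
      using exists_noiseless_distribution[of g X B q] g G(1) assms(6) by blast
    have "d < 2 ^ (4 * n + 1)"
      by (rule order.strict_trans2[OF d(2) power_increasing]) (simp_all add: True)
    then have "thr = 0"
      using True by (simp add: thr_def)
    then have "\<exists>P\<in>distributions X B. \<exists>g\<in>G. thr \<le> expected_risk q n P ghat - risk q P g" for ghat
      using P g expected_risk_nonneg[of q n P ghat] by (intro bexI[of _ P] bexI[of _ g]) auto
    then show ?thesis
      using G by blast
  next
    case False
    \<comment> \<open>For \<open>m > 4n\<close> only \<open>4n\<close> of the \<open>m\<close> points are used, so that \<open>\<delta>\<close> is at most 1.\<close>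
    define k where "k = min m (4 * n)"
    define \<delta> where "\<delta> = sqrt (real k / (4 * real n))"
    have k: "0 < k" "k \<le> m"
      using False assms(3) by (auto simp: k_def)
    \<comment> \<open>Thus \<open>\<delta>\<close> is exactly the square root in the hypothesis on
      \<open>q\<close>.\<close>
    have kn: "real k / (4 * real n) = min (real m / (4 * real n)) 1"
      using assms(3) by (auto simp: k_def min_def field_simps)
    have \<delta>: "0 \<le> \<delta>" "\<delta> \<le> 1" "q \<le> 1 + \<delta>" "4 * real n * \<delta>\<^sup>2 \<le> real k"
    proof -
      have "real k \<le> 4 * real n"
        using min.cobounded2[of m "4 * n"] unfolding k_def by linarith
      then show "0 \<le> \<delta>" "\<delta> \<le> 1" "4 * real n * \<delta>\<^sup>2 \<le> real k"
        using assms(3) by (simp_all add: \<delta>_def)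
      show "q \<le> 1 + \<delta>"
        using assms(5) unfolding \<delta>_def kn floor by simp
    qed
    \<comment> \<open>Both branches of the claim are one formula: \<open>m \<le> 4 * n\<close> holds
      exactly when \<open>d < 2 ^ (4 * n + 1)\<close>, and then
      \<open>sqrt (m / n) = 2 * \<delta>\<close>; otherwise \<open>\<delta> = 1\<close>.\<close>
    have thr: "thr = 2 * c_const q * \<delta> * B powr q"
    proof (cases "m \<le> 4 * n")
      case True
      have "d < 2 ^ (4 * n + 1)"
        by (rule order.strict_trans2[OF d(2) power_increasing]) (simp_all add: True)
      moreover have "sqrt (real m / real n) = 2 * \<delta>"
        using True by (simp add: \<delta>_def k_def real_sqrt_divide real_sqrt_mult)
      ultimately show ?thesis
        by (simp add: thr_def)
    next
      case False
      have "2 ^ (4 * n + 1) \<le> d"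
        using False by (intro order.trans[OF power_increasing d(1)]) auto
      moreover have "\<delta> = 1"
        using False assms(3) by (simp add: \<delta>_def k_def)
      ultimately show ?thesis
        by (simp add: thr_def)
    qed
    obtain x where x: "range x \<subseteq> space X" "inj_on x {..<k}"
      using exists_points[of "space X" k] assms(6,8) k(2) floor by fastforce
    obtain u where u: "\<bar>u\<bar> \<le> B" and hyper: "\<And>ghat. estimator X B q n ghat \<Longrightarrow>
      (\<exists>P\<in>distributions X B. \<exists>\<sigma>. \<forall>g\<in>prediction_functions X B.
        (\<forall>j<k. g (x j) = (if \<sigma> j then u else - u)) \<longrightarrow>
        2 * c_const q * \<delta> * B powr q \<le> expected_risk q n P ghat - risk q P g)"
      using exists_hypercube_distribution[OF assms(1,4) \<delta>(3,1,2) k(1) \<delta>(4) x(1)] by blast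
    define S :: "(nat \<Rightarrow> bool) set" where "S = {..<k} \<rightarrow>\<^sub>E UNIV"
    have "\<forall>\<sigma>. \<exists>g. g \<in> prediction_functions X B \<and> (\<forall>j<k. g (x j) = (if \<sigma> j then u else - u))"
      using exists_two_valued_prediction[OF assms(7) x(2) _ u] x(1) by blast
    then have "\<exists>g. \<forall>\<sigma>. g \<sigma> \<in> prediction_functions X B \<and> (\<forall>j<k. g \<sigma> (x j) = (if \<sigma> j then u else - u))"
      by (rule choice)
    then obtain g where g: "\<And>\<sigma>. g \<sigma> \<in> prediction_functions X B"
      "\<And>\<sigma> j. j < k \<Longrightarrow> g \<sigma> (x j) = (if \<sigma> j then u else - u)"
      by blast
    have "finite S" "card S = 2 ^ k"
      by (simp_all add: S_def finite_PiE card_funcsetE)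
    \<comment> \<open>One predictor per pattern fits into \<open>d\<close> functions, as
      \<open>2 ^ k \<le> 2 ^ m \<le> d\<close>; padding then brings the cardinality to exactly
      \<open>d\<close>.\<close>
    then have "card (g ` S) \<le> 2 ^ k"
      using card_image_le[of S g] by simp
    also have "\<dots> \<le> d"
      by (rule order.trans[OF power_increasing[OF k(2)] d(1)]) simp
    finally obtain G where G: "g ` S \<subseteq> G" "G \<subseteq> prediction_functions X B" "finite G" "card G = d"
      using exists_superset_with_card[OF infinite_prediction_functions[OF assms(1,6)], of "g ` S" d]
        g(1) \<open>finite S\<close> by blast
    have "\<exists>P\<in>distributions X B. \<exists>g\<in>G. thr \<le> expected_risk q n P ghat - risk q P g"
      if est: "estimator X B q n ghat" for ghat
    proof -
      obtain P \<sigma> where P: "P \<in> distributions X B"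
        and le: "\<And>h. h \<in> prediction_functions X B \<Longrightarrow> \<forall>j<k. h (x j) = (if \<sigma> j then u else - u)
          \<Longrightarrow> 2 * c_const q * \<delta> * B powr q \<le> expected_risk q n P ghat - risk q P h"
        using hyper[OF est] by blast
      \<comment> \<open>The pattern obtained is arbitrary from \<open>k\<close> on; its restriction
        lies in \<open>S\<close> and agrees with it at all indices below \<open>k\<close>.\<close>
      have "g (restrict \<sigma> {..<k}) \<in> G"
        using G(1) by (auto simp: S_def)
      moreover have "thr \<le> expected_risk q n P ghat - risk q P (g (restrict \<sigma> {..<k}))"
        unfolding thr by (rule le) (simp_all add: g)
      ultimately show ?thesis
        using P by blast
    qed
    then show ?thesis
      using G by blast
  qed
  then obtain G where G: "G \<subseteq> prediction_functions X B" "finite G" "card G = d"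
    and lower: "\<And>ghat. estimator X B q n ghat \<Longrightarrow>
      \<exists>P\<in>distributions X B. \<exists>g\<in>G. thr \<le> expected_risk q n P ghat - risk q P g"
    by blast
  have excess: "\<exists>P\<in>distributions X B. thr \<le> expected_risk q n P ghat - (MIN g\<in>G. risk q P g)"
    if est: "estimator X B q n ghat" for ghat
  proof -
    obtain P g where P: "P \<in> distributions X B" and g: "g \<in> G"
      "thr \<le> expected_risk q n P ghat - risk q P g"
      using lower[OF est] by blast
    have "(MIN g\<in>G. risk q P g) \<le> risk q P g"
      using G(2) g(1) by (intro Min_le) auto
    then show ?thesis
      using P g(2) by (intro bexI[of _ P]) auto
  qed
  have thr_eq: "thr = (if card G < 2 ^ (4 * n + 1)
      then c_const q * B powr q * sqrt (real_of_int \<lfloor>log 2 (real (card G))\<rfloor> / real n)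
      else 2 * c_const q * B powr q)"
    by (simp add: thr_def G(3) floor)
  show ?thesis
  proof (rule exI[of _ G], intro conjI allI impI)
    fix ghat assume "estimator X B q n ghat"
    then show "\<exists>P\<in>distributions X B. expected_risk q n P ghat - (MIN g\<in>G. risk q P g) \<ge>
      (if card G < 2 ^ (4 * n + 1)
       then c_const q * B powr q * sqrt (real_of_int \<lfloor>log 2 (real (card G))\<rfloor> / real n)
       else 2 * c_const q * B powr q)"
      unfolding thr_eq[symmetric] by (rule excess)
  qed (fact G)+
qed

end
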